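(* Let $L$ be a finite lattice consisting of at least two elements. (1) If $L$ is meet-distributive and $Y$ is a CD-independent subset of $L$, then $|Y|\leq \mathrm{length}(L)+|\mathrm{Atoms}(L)|$. In the rest of the theorem, let $X$ be a subset of $L$ such that $\{0,1\}\cup \mathrm{Atoms}(L)\subseteq X$. Denote $|\max(X\setminus\{1\})|$ by $k$, and let $\max(X\setminus\{1\})=\{a_1,\dots,a_k\}$. (2) If $L$ is dually slim and lower semimodular (equivalently, dually slim and meet-distributive), then the following three conditions (a), (b), (c) are equivalent. (a) $X$ is a maximal CD-independent subset of $L$. (b) Either (i) $k=1$, $a_1$ is a coatom of $L$, and $X\setminus\{1\}$ is a maximal CD-independent subset of $\mathord\downarrow a_1$, or (ii) $k=2$, $\langle a_1,a_2\rangle\in \mathrm{ComplP}(L)\cap \mathrm{PseudCP}(L)$, $\{a_1,a_2\}\subseteq \mathrm{Mi}(L)$, and $X\cap \mathord\downarrow a_i$ is a maximal CD-independent subset of $\mathord\downarrow a_i$ for $i=1,2$. (c) Either (i) $k=1$, $a_1$ is a coatom of $L$, and $X\setminus\{1\}$ is a maximal CD-independent subset of $\mathord\downarrow a_1$, or (ii) $k=2$, $\langle a_1,a_2\rangle\in \mathrm{ComplP}(L)\cap \mathrm{PseudCP}(L)$, $a_1\parallel a_2$, and $X\cap \mathord\downarrow a_i$ is a maximal CD-independent subset of $\mathord\downarrow a_i$ for $i=1,2$. (3) If $L$ is distributive, then the following two conditions (a), (b) are equivalent. (a) $X$ is a maximal CD-independent subset of $L$. (b) Either (i) $k=1$, $a_1$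 is a coatom of $L$, and $X\setminus\{1\}$ is a maximal CD-independent subset of $\mathord\downarrow a_1$, or (ii) $k=2$, $\langle a_1,a_2\rangle\in \mathrm{ComplP}(L)$, $a_1\parallel a_2$, and $X\cap \mathord\downarrow a_i$ is a maximal CD-independent subset of $\mathord\downarrow a_i$ for $i=1,2$.
   Context: All lattices are finite; $0$ and $1$ denote the least and greatest elements of $L$. We write $x\parallel y$ if $x$ and $y$ are incomparable, and $x\prec y$ if $y$ covers $x$; $x\preceq y$ means $x\prec y$ or $x=y$. For $u\in L$, $\mathord\downarrow u=\{x\in L: x\leq u\}$ is the principal ideal, considered as a lattice (with least element $0$ and greatest element $u$). CD-independence: a subset $X$ of a lattice $L$ is CD-independent if for all $x,y\in X$ with $x\parallel y$ we have $x\wedge y=0$. A maximal CD-independent subset is one that is maximal with respect to inclusion among the CD-independent subsets of the lattice. Meet-distributive: for $u\in L\setminus\{0\}$ let $u_\ast$ denote the meet of all lower covers of $u$; a finite lattice $L$ is meet-distributive if the interval $[u_\ast,u]$ is a distributive lattice for every $u\in L\setminus\{0\}$. Lower semimodular: $a\prec b$ implies $a\wedge c\preceq b\wedge c$ for all $a,b,c\in L$. $\mathrm{Mi}(L)$ is the set of meet-irreducible elements of $L$, i.e. elements having exactly one (upper) cover. $L$ is dually slim if $\mathrm{Mi}(L)$ contains no three-element antichain. $\mathrm{Atoms}(L)$ is the set of atoms of $L$ and $\mathrm{length}(L)$ is the length of $L$, i.e. the maximum size of a chain in $L$ minus $1$. A coatom is a lower cover of $1$. For a poset $H$, $\max(H)$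 is the set of maximal elements of $H$. For $a,b\in L$, $\langle a,b\rangle$ is a complemented pair if $a\wedge b=0$ and $a\vee b=1$. The pseudocomplement of $a\in L$, if it exists, is the largest element $c\in L$ such that $a\wedge c=0$. The pair $\langle a,b\rangle$ is a pseudocomplemented pair if $b$ is the pseudocomplement of $a$ and $a$ is the pseudocomplement of $b$. $\mathrm{ComplP}(L)$ and $\mathrm{PseudCP}(L)$ denote the sets of all complemented pairs and of all pseudocomplemented pairs $\langle a,b\rangle\in L^2$, respectively. *)

theory Defs
  imports Main
begin

text \<open>
  A finite lattice \<open>L\<close> is a type of sort \<open>{finite, bounded_lattice}\<close>; every nonempty finite
  lattice has a least element \<open>bot\<close> (the 0 of \<open>L\<close>) and a greatest element \<open>top\<close> (the 1 of \<open>L\<close>).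
  Properties of the lattice as a whole take the type as an argument of type \<open>'a itself\<close>.
\<close>

definition covered_by :: "'a::order \<Rightarrow> 'a \<Rightarrow> bool"  (infix \<open>\<prec>\<close> 50)
  where "x \<prec> y \<longleftrightarrow> x < y \<and> \<not> (\<exists>z. x < z \<and> z < y)"

definition covered_by_or_eq :: "'a::order \<Rightarrow> 'a \<Rightarrow> bool"  (infix \<open>\<preceq>\<close> 50)
  where "x \<preceq> y \<longleftrightarrow> x \<prec> y \<or> x = y"

definition incomparable :: "'a::order \<Rightarrow> 'a \<Rightarrow> bool"  (infix \<open>\<parallel>\<close> 50)
  where "x \<parallel> y \<longleftrightarrow> \<not> x \<le> y \<and> \<not> y \<le> x"

definition maximals :: "'a::order set \<Rightarrow> 'a set"
  where "maximals H = {x \<in> H. \<not> (\<exists>y\<in>H. x < y)}"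

definition Atoms :: "'a::{finite,bounded_lattice} set"
  where "Atoms = {a. bot \<prec> a}"

definition coatom :: "'a::{finite,bounded_lattice} \<Rightarrow> bool"
  where "coatom a \<longleftrightarrow> a \<prec> top"

definition Mi :: "'a::{finite,bounded_lattice} set"
  where "Mi = {x. \<exists>!y. x \<prec> y}"

definition lattice_length :: "'a::{finite,bounded_lattice} itself \<Rightarrow> nat"
  where "lattice_length (_ :: 'a itself) =
    Max (card ` {C :: 'a set. Complete_Partial_Order.chain (\<le>) C}) - 1"

text \<open>Used only for sets \<open>A\<close> closed under \<open>inf\<close> and \<open>sup\<close>: intervals and the whole lattice.\<close>

definition distributive_on :: "'a::lattice set \<Rightarrow> bool"
  where "distributive_on A \<longleftrightarrow>
    (\<forall>x\<in>A. \<forall>y\<in>A. \<forall>z\<in>A. inf x (sup y z) = sup (inf x y) (inf x z))"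

text \<open>
  The meet of all lower covers of \<open>u\<close>; it is meaningful only for \<open>u \<noteq> bot\<close>, when the set of lower
  covers is nonempty.
\<close>

definition lower_star :: "'a::{finite,bounded_lattice} \<Rightarrow> 'a"
  where "lower_star u = Inf_fin {v. v \<prec> u}"

definition meet_distributive :: "'a::{finite,bounded_lattice} itself \<Rightarrow> bool"
  where "meet_distributive (_ :: 'a itself) \<longleftrightarrow>
    (\<forall>u :: 'a. u \<noteq> bot \<longrightarrow> distributive_on {lower_star u..u})"

definition lower_semimodular :: "'a::{finite,bounded_lattice} itself \<Rightarrow> bool"
  where "lower_semimodular (_ :: 'a itself) \<longleftrightarrow>
    (\<forall>a b c :: 'a. a \<prec> b \<longrightarrow> inf a c \<preceq> inf b c)"

definition antichain :: "'a::order set \<Rightarrow> bool"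
  where "antichain S \<longleftrightarrow> (\<forall>x\<in>S. \<forall>y\<in>S. x \<noteq> y \<longrightarrow> x \<parallel> y)"

definition dually_slim :: "'a::{finite,bounded_lattice} itself \<Rightarrow> bool"
  where "dually_slim (_ :: 'a itself) \<longleftrightarrow>
    \<not> (\<exists>S \<subseteq> (Mi :: 'a set). card S = 3 \<and> antichain S)"

text \<open>
  Here \<open>A\<close> is the carrier of the lattice in which CD-independence is considered: \<open>UNIV\<close> for \<open>L\<close>
  itself, or a principal ideal \<open>{..u}\<close>.  Order, meet and least element of a principal ideal are
  those of \<open>L\<close>, so \<open>inf\<close> and \<open>bot\<close> are used in both cases.
\<close>

definition CD_independent :: "'a::{finite,bounded_lattice} set \<Rightarrow> 'a set \<Rightarrow> bool"
  where "CD_independent A X \<longleftrightarrow>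
    X \<subseteq> A \<and> (\<forall>x\<in>X. \<forall>y\<in>X. x \<parallel> y \<longrightarrow> inf x y = bot)"

definition maximal_CD_independent :: "'a::{finite,bounded_lattice} set \<Rightarrow> 'a set \<Rightarrow> bool"
  where "maximal_CD_independent A X \<longleftrightarrow>
    CD_independent A X \<and> (\<forall>Y. CD_independent A Y \<and> X \<subseteq> Y \<longrightarrow> Y = X)"

definition ComplP :: "('a::{finite,bounded_lattice} \<times> 'a) set"
  where "ComplP = {(a, b). inf a b = bot \<and> sup a b = top}"

definition is_pseudocomplement :: "'a::{finite,bounded_lattice} \<Rightarrow> 'a \<Rightarrow> bool"
  where "is_pseudocomplement a c \<longleftrightarrow>
    inf a c = bot \<and> (\<forall>d. inf a d = bot \<longrightarrow> d \<le> c)"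

definition PseudCP :: "('a::{finite,bounded_lattice} \<times> 'a) set"
  where "PseudCP = {(a, b). is_pseudocomplement a b \<and> is_pseudocomplement b a}"

end

theory Submission
  imports Defs
begin

text \<open>
  Counting. A finite lattice element is determined by the join-irreducible elements below it, and
  two elements meet in \<open>bot\<close> exactly when no join-irreducible element lies below both. Hence a
  CD-independent set without \<open>bot\<close> is a laminar family of nonempty sets of join-irreducibles, a
  forest. A leaf, and a node with a single child, owns a join-irreducible that lies below no smaller
  member; the branchings of the forest are outnumbered by its leaves, and disjoint leaves lie above
  different atoms. So \<open>card Y \<le> card Ji + card Atoms\<close>, where the one unit to spare is for \<open>bot\<close>, in
  every finite lattice with \<open>bot \<noteq> top\<close> (\<open>card_CD_independent_le\<close>).
  Meet-distributivity enters only to bound \<open>card Ji\<close> by the length: going up one cover adds exactly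
  one join-irreducible (\<open>Ji_unique_across_cover\<close>), so a maximal chain is long enough.

  Slimness. Elements are called disjoint here if their meet is \<open>bot\<close>. In place of a decomposition of \<open>Mi\<close> into two chains, the proof uses two consequences of
  the missing three-element antichain. Among any three elements, one lies below the join of the
  other two (\<open>dually_slim_le_sup\<close>); and if \<open>z\<close> lies between the disjoint elements \<open>x\<close> and \<open>y\<close> and is
  disjoint from \<open>y\<close>, then \<open>sup x z\<close> is still disjoint from \<open>y\<close> (\<open>dually_slim_between\<close>). Both hold
  because meet-irreducibles separating the elements concerned would form a three-element antichain.

  Structure of a maximal CD-independent set \<open>X\<close>. Distinct maximal elements of \<open>X - {top}\<close> are
  disjoint. If there were three or more, two of them would have a join disjoint from all the others
  (\<open>disjoint_join_property\<close>), and this join could be added to \<open>X\<close>. So there are one or two, and in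
  each case \<open>X\<close> is assembled from its parts in the ideals below them. Two maximal elements join to
  \<open>top\<close>, and the betweenness facts make them pseudocomplements of each other and meet-irreducible.
  Conversely, an element that could be added to such an \<open>X\<close> is ruled out by
  pseudocomplementation if there are two maximal elements. If there is just one, a coatom, then the
  additional element is disjoint from it, hence an atom by lower semimodularity; but all atoms are
  in \<open>X\<close>. In a distributive lattice the join property and the pseudocomplements come directly from
  the distributive law, and lower semimodularity from meet-distributivity.
\<close>

section \<open>Finite lattices: covers and irreducible elements\<close>

lemma finite_order_induct [case_names less]:
  fixes x :: "'a::{finite,order}"
  assumes "\<And>x::'a. (\<And>y. y < x \<Longrightarrow> P y) \<Longrightarrow> P x"
  shows "P x"
proof (induction x rule: measure_induct_rule[of "\<lambda>x. card {..x}"])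
  case (less x)
  have "card {..y} < card {..x}" if "y < x" for y :: 'a
    using that by (intro psubset_card_mono) auto
  then show ?case by (intro assms[of x] less)
qed

lemma ex_lower_cover_above:
  fixes x y :: "'a::{finite,order}"
  assumes "x < y"
  obtains v where "x \<le> v" "v \<prec> y"
proof -
  obtain v where v: "v \<in> {v. v < y}" "x \<le> v" and max: "\<forall>w\<in>{v. v < y}. v \<le> w \<longrightarrow> v = w"
    using finite_has_maximal2[of "{v. v < y}" x] assms by auto
  have "v \<prec> y"
    using v max by (auto simp: covered_by_def dest: less_imp_le)
  with v show thesis by (auto intro: that)
qed

lemma ex_atom_le:
  fixes x :: "'a::{finite,bounded_lattice}"
  assumes "x \<noteq> bot"
  obtains p where "p \<in> Atoms" "p \<le> x"
proof -
  obtain p where p: "p \<in> - {bot}" "p \<le> x" and min: "\<forall>q\<in>- {bot}. q \<le> p \<longrightarrow> p = q"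
    using finite_has_minimal2[of "- {bot}" x] assms by auto
  have "p \<in> Atoms"
    using p min by (auto simp: Atoms_def covered_by_def bot.not_eq_extremum dest: less_imp_le)
  with p show thesis by (auto intro: that)
qed

lemma le_maximals:
  fixes x :: "'a::{finite,order}"
  assumes "x \<in> A"
  obtains m where "m \<in> maximals A" "x \<le> m"
  using finite_has_maximal2[of A x] assms by (fastforce simp: maximals_def)

lemma sup_eq_of_covered_by:
  fixes a x :: "'a::lattice"
  assumes "a \<prec> b" "x \<le> b" "\<not> x \<le> a"
  shows "sup a x = b"
proof -
  have "a < sup a x" using assms(3) by (simp add: less_le_not_le)
  moreover have "sup a x \<le> b" using assms by (auto simp: covered_by_def)
  ultimately show ?thesis using assms(1) by (auto simp: covered_by_def le_less)
qed

definition Ji :: "'a::{finite,bounded_lattice} set"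
  where "Ji = {p. \<exists>!v. v \<prec> p}"

lemma le_lower_cover_of_Ji:
  fixes p :: "'a::{finite,bounded_lattice}"
  assumes "p \<in> Ji" "v \<prec> p" "x < p"
  shows "x \<le> v"
  using assms ex_lower_cover_above[of x p] by (auto simp: Ji_def)

lemma Atoms_subset_Ji: "Atoms \<subseteq> (Ji :: 'a::{finite,bounded_lattice} set)"
proof
  fix p :: 'a assume "p \<in> Atoms"
  then have p: "bot \<prec> p" by (simp add: Atoms_def)
  have "v = bot" if "v \<prec> p" for v
    using p that bot.not_eq_extremum[of v] by (auto simp: covered_by_def)
  with p show "p \<in> Ji" by (auto simp: Ji_def)
qed

text \<open>
  A minimal element among those below \<open>u\<close> but not below \<open>v\<close> cannot be the join of two smaller
  elements, since these would both lie below \<open>v\<close>.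
\<close>

lemma Ji_separates:
  fixes u v :: "'a::{finite,bounded_lattice}"
  assumes "\<not> u \<le> v"
  obtains p where "p \<in> Ji" "p \<le> u" "\<not> p \<le> v"
proof -
  let ?S = "{p. p \<le> u \<and> \<not> p \<le> v}"
  obtain p where p: "p \<in> ?S" and min: "\<forall>q\<in>?S. q \<le> p \<longrightarrow> p = q"
    using finite_has_minimal2[of ?S u] assms by auto
  have below: "q \<le> v" if "q < p" for q
    using that p min by (metis (no_types, lifting) less_le mem_Collect_eq order_trans)
  have "bot < p" using p bot.not_eq_extremum[of p] by auto
  then obtain c where c: "c \<prec> p" by (rule ex_lower_cover_above)
  have "d = c" if d: "d \<prec> p" for d
  proof (rule ccontr)
    assume "d \<noteq> c"
    then have "\<not> d \<le> c" using c d by (auto simp: covered_by_def less_le)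
    then have "sup c d = p" using c d by (intro sup_eq_of_covered_by) (auto simp: covered_by_def)
    moreover have "sup c d \<le> v" using c d below by (simp add: covered_by_def)
    ultimately show False using p by simp
  qed
  with c have "p \<in> Ji" by (auto simp: Ji_def)
  with p show thesis by (auto intro: that)
qed

text \<open>
  Dually, a maximal element among those above \<open>v\<close> but not above \<open>u\<close> is meet-irreducible.
\<close>

lemma Mi_separates:
  fixes u v :: "'a::{finite,bounded_lattice}"
  assumes "\<not> u \<le> v"
  obtains m where "m \<in> Mi" "v \<le> m" "\<not> u \<le> m"
proof -
  let ?S = "{m. v \<le> m \<and> \<not> u \<le> m}"
  obtain m where m: "m \<in> ?S" and max: "\<forall>q\<in>?S. m \<le> q \<longrightarrow> m = q"
    using finite_has_maximal2[of ?S v] assms by auto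
  have above: "u \<le> q" if "m < q" for q
    using that m max by (metis (no_types, lifting) less_le mem_Collect_eq order_trans)
  have "m < top" using m top.not_eq_extremum[of m] by auto
  then obtain c where c: "c \<in> {c. m < c}" and minc: "\<forall>d\<in>{c. m < c}. d \<le> c \<longrightarrow> c = d"
    using finite_has_minimal2[of "{c. m < c}" top] by auto
  have mc: "m \<prec> c" using c minc by (auto simp: covered_by_def dest: less_imp_le)
  have "d = c" if d: "m \<prec> d" for d
  proof (rule ccontr)
    assume "d \<noteq> c"
    then have "\<not> c \<le> d" using mc d by (auto simp: covered_by_def less_le)
    then have "inf c d < c" by (simp add: less_le_not_le)
    moreover have "m \<le> inf c d" using mc d by (auto simp: covered_by_def)
    ultimately have "inf c d = m" using mc by (auto simp: covered_by_def le_less)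
    moreover have "u \<le> inf c d" using mc d above by (simp add: covered_by_def)
    ultimately show False using m by simp
  qed
  with mc have "m \<in> Mi" by (auto simp: Mi_def)
  with m show thesis by (auto intro: that)
qed

section \<open>The size of a CD-independent set\<close>

text \<open>
  The induction for the bound runs over principal ideals and needs one set per ideal whose
  cardinality is \<open>card Ji + card Atoms\<close> there. A disjoint sum is used because every atom is
  join-irreducible and has to be counted twice.
\<close>

definition tokens :: "'a::{finite,bounded_lattice} \<Rightarrow> ('a + 'a) set"
  where "tokens u = (Ji \<inter> {..u}) <+> (Atoms \<inter> {..u})"

lemma tokens_mono: "u \<le> v \<Longrightarrow> tokens u \<subseteq> tokens v"
  by (auto simp: tokens_def)

lemma tokens_strict_mono:
  assumes "u < v"
  shows "tokens u \<subset> tokens v"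
proof -
  have "\<not> v \<le> u" using assms by auto
  then obtain p where "p \<in> Ji" "p \<le> v" "\<not> p \<le> u" by (rule Ji_separates)
  then have "Inl p \<in> tokens v - tokens u" by (auto simp: tokens_def)
  with tokens_mono[OF less_imp_le[OF assms]] show ?thesis by blast
qed

lemma tokens_disjoint:
  assumes "inf u v = bot"
  shows "tokens u \<inter> tokens v = {}"
proof -
  have "p = bot" if "p \<le> u" "p \<le> v" for p
    using that assms by (metis le_inf_iff bot.extremum_uniqueI)
  moreover have "bot \<notin> (Ji :: 'a set)" "bot \<notin> (Atoms :: 'a set)"
    by (auto simp: Ji_def Atoms_def covered_by_def)
  ultimately show ?thesis by (auto simp: tokens_def)
qed

lemma two_le_card_tokens:
  assumes "u \<noteq> bot"
  shows "2 \<le> card (tokens u)"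
proof -
  obtain p where "p \<in> Atoms" "p \<le> u" using assms by (rule ex_atom_le)
  then have "{Inl p, Inr p} \<subseteq> tokens u" using Atoms_subset_Ji by (auto simp: tokens_def)
  then have "card {Inl p, Inr p} \<le> card (tokens u)" by (intro card_mono) auto
  then show ?thesis by simp
qed

lemma maximals_inf_bot:
  assumes "\<And>x y. x \<in> A \<Longrightarrow> y \<in> A \<Longrightarrow> x \<parallel> y \<Longrightarrow> inf x y = bot"
    and "x \<in> maximals A" "y \<in> maximals A" "x \<noteq> y"
  shows "inf x y = bot"
  using assms by (intro assms(1)) (auto simp: maximals_def incomparable_def less_le)

text \<open>
  Apart from \<open>u\<close> itself, every element of \<open>Y - {bot}\<close> lies below one of the maximal elements
  \<open>m\<close> of the rest, whose token sets are pairwise disjoint. By induction, each of these ideals leaves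
  one token to spare. Of two or more spare tokens, one pays for \<open>u\<close> and another keeps the inequality
  strict. If there is only one \<open>m\<close>, a join-irreducible gained between \<open>m\<close> and \<open>u\<close> pays for \<open>u\<close>;
  if there is none, the two tokens of an atom below \<open>u\<close> suffice.
\<close>

lemma card_CD_independent_less_card_tokens:
  fixes u :: "'a::{finite,bounded_lattice}"
  assumes "u \<noteq> bot" "CD_independent {..u} Y"
  shows "card (Y - {bot}) < card (tokens u)"
  using assms
proof (induction u arbitrary: Y rule: finite_order_induct)
  case (less u)
  define M where "M = maximals (Y - {bot, u})"
  have M: "m \<noteq> bot" "m < u" if "m \<in> M" for m
    using that less.prems(2) by (auto simp: M_def maximals_def CD_independent_def)
  have disj: "inf m n = bot" if "m \<in> M" "n \<in> M" "m \<noteq> n" for m n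
    using that less.prems(2) maximals_inf_bot[of "Y - {bot, u}" m n]
    by (auto simp: M_def CD_independent_def)
  have IH: "card (Y \<inter> {..m} - {bot}) + 1 \<le> card (tokens m)" if "m \<in> M" for m
  proof -
    have "CD_independent {..m} (Y \<inter> {..m})"
      using less.prems(2) by (auto simp: CD_independent_def)
    with less.IH[of m "Y \<inter> {..m}"] M[OF that] show ?thesis by simp
  qed
  have "Y - {bot} \<subseteq> {u} \<union> (\<Union>m\<in>M. Y \<inter> {..m} - {bot})"
  proof
    fix y assume y: "y \<in> Y - {bot}"
    show "y \<in> {u} \<union> (\<Union>m\<in>M. Y \<inter> {..m} - {bot})"
    proof (cases "y = u")
      case False
      with y obtain m where "m \<in> M" "y \<le> m"
        unfolding M_def by (metis Diff_iff insert_iff le_maximals)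
      with y show ?thesis by auto
    qed simp
  qed
  then have "card (Y - {bot}) \<le> card ({u} \<union> (\<Union>m\<in>M. Y \<inter> {..m} - {bot}))"
    by (intro card_mono) auto
  also have "\<dots> \<le> card {u} + card (\<Union>m\<in>M. Y \<inter> {..m} - {bot})" by (rule card_Un_le)
  also have "\<dots> \<le> 1 + (\<Sum>m\<in>M. card (Y \<inter> {..m} - {bot}))"
    using card_UN_le[of M "\<lambda>m. Y \<inter> {..m} - {bot}"] by simp
  finally have "card (Y - {bot}) + card M \<le> 1 + (\<Sum>m\<in>M. card (Y \<inter> {..m} - {bot}) + 1)"
    by (simp add: sum_Suc)
  also have "\<dots> \<le> 1 + (\<Sum>m\<in>M. card (tokens m))"
    using IH by (intro add_left_mono sum_mono) auto
  also have "(\<Sum>m\<in>M. card (tokens m)) = card (\<Union>m\<in>M. tokens m)"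
    by (rule card_UN_disjoint[symmetric]) (simp_all add: tokens_disjoint[OF disj])
  finally have bound: "card (Y - {bot}) + card M \<le> 1 + card (\<Union>m\<in>M. tokens m)" .
  consider "M = {}" | m where "M = {m}" | "2 \<le> card M"
  proof -
    have "card M = 0 \<or> card M = 1 \<or> 2 \<le> card M" by linarith
    then show thesis using that by (auto simp: card_1_singleton_iff)
  qed
  then show ?case
  proof cases
    case 1
    with bound two_le_card_tokens[OF less.prems(1)] show ?thesis by simp
  next
    case (2 m)
    have "card (tokens m) < card (tokens u)"
      using M[of m] 2 by (intro psubset_card_mono tokens_strict_mono) auto
    with bound 2 show ?thesis by simp
  next
    case 3
    have "(\<Union>m\<in>M. tokens m) \<subseteq> tokens u"
      using M tokens_mono by (metis UN_least less_imp_le)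
    then have "card (\<Union>m\<in>M. tokens m) \<le> card (tokens u)" by (intro card_mono) auto
    with bound 3 show ?thesis by simp
  qed
qed

lemma card_CD_independent_le:
  fixes Y :: "'a::{finite,bounded_lattice} set"
  assumes "(bot::'a) \<noteq> top" "CD_independent UNIV Y"
  shows "card Y \<le> card (Ji :: 'a set) + card (Atoms :: 'a set)"
proof -
  have "CD_independent {..top} Y" using assms(2) by (auto simp: CD_independent_def)
  then have "card (Y - {bot}) < card (tokens (top::'a))"
    using assms(1) by (intro card_CD_independent_less_card_tokens) auto
  moreover have "card Y \<le> card (Y - {bot}) + 1"
    using card_Suc_Diff1[of Y bot] by (cases "bot \<in> Y") simp_all
  moreover have "card (tokens (top::'a)) = card (Ji :: 'a set) + card (Atoms :: 'a set)"
    by (simp add: tokens_def card_Plus atMost_eq_UNIV_iff[THEN iffD2])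
  ultimately show ?thesis by linarith
qed

section \<open>Meet-distributive lattices\<close>

lemma lower_star_le: "v \<prec> u \<Longrightarrow> lower_star u \<le> v"
  by (auto simp: lower_star_def intro: Inf_fin.coboundedI)

lemma inf_sup_distrib_near:
  fixes u :: "'a::{finite,bounded_lattice}"
  assumes "meet_distributive TYPE('a)"
    and "lower_star u \<le> x" "x \<le> u" "lower_star u \<le> y" "y \<le> u" "lower_star u \<le> z" "z \<le> u"
  shows "inf x (sup y z) = sup (inf x y) (inf x z)"
proof (cases "u = bot")
  case True
  then show ?thesis using assms bot.extremum_uniqueI by fastforce
next
  case False
  then show ?thesis using assms by (auto simp: meet_distributive_def distributive_on_def)
qed

text \<open>
  The modular law in the interval from \<open>lower_star u\<close> to \<open>u\<close>: an element strictly between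
  \<open>inf v w\<close> and \<open>w\<close> would join with \<open>v\<close> to \<open>u\<close>, and distributing \<open>w\<close> over that join would make
  the element equal to \<open>w\<close>.
\<close>

lemma inf_lower_covers_covered:
  fixes u :: "'a::{finite,bounded_lattice}"
  assumes md: "meet_distributive TYPE('a)" and v: "v \<prec> u" and w: "w \<prec> u" and "v \<noteq> w"
  shows "inf v w \<prec> w"
proof -
  have nle: "\<not> w \<le> v" using v w \<open>v \<noteq> w\<close> by (auto simp: covered_by_def less_le)
  have "False" if x: "inf v w < x" "x < w" for x
  proof -
    have "\<not> x \<le> v" using x by (meson le_inf_iff less_le_not_le order_trans)
    moreover have "x \<le> u" using x w by (auto simp: covered_by_def)
    ultimately have "sup v x = u" using v by (intro sup_eq_of_covered_by)
    then have "inf w (sup v x) = w" using w by (simp add: covered_by_def inf_absorb1 less_imp_le)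
    moreover have "inf w (sup v x) = sup (inf w v) (inf w x)"
    proof (rule inf_sup_distrib_near[OF md, of u])
      have "lower_star u \<le> inf v w" using v w by (simp add: lower_star_le)
      then show "lower_star u \<le> x" using x by (metis less_imp_le order_trans)
    qed (use v w \<open>x \<le> u\<close> in \<open>auto simp: lower_star_le covered_by_def\<close>)
    moreover have "sup (inf w v) (inf w x) = x"
      using x by (simp add: inf_absorb2 inf.commute sup_absorb2 less_imp_le)
    ultimately show False using x by simp
  qed
  moreover have "inf v w < w" using nle by (simp add: less_le_not_le)
  ultimately show ?thesis by (auto simp: covered_by_def)
qed

text \<open>
  It suffices to cut a cover \<open>a \<prec> b\<close> by some \<open>c < b\<close>. Choose a lower cover \<open>d\<close> of \<open>b\<close>
  above \<open>c\<close>. The square of \<open>a\<close>, \<open>d\<close> and \<open>b\<close> moves the cover down to \<open>inf a d \<prec> d\<close>, where the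
  induction on \<open>b\<close> applies.
\<close>

lemma meet_distributive_imp_lower_semimodular:
  assumes md: "meet_distributive TYPE('a::{finite,bounded_lattice})"
  shows "lower_semimodular TYPE('a)"
proof -
  have below: "inf a c \<preceq> c" if "a \<prec> b" "c \<le> b" for a b c :: 'a
    using that
  proof (induction b arbitrary: a rule: finite_order_induct)
    case (less b)
    show ?case
    proof (cases "c = b \<or> c \<le> a")
      case True
      with less.prems show ?thesis
        by (auto simp: covered_by_or_eq_def covered_by_def inf_absorb1 inf_absorb2)
    next
      case False
      with less.prems have "c < b" by auto
      then obtain d where d: "c \<le> d" "d \<prec> b" by (rule ex_lower_cover_above)
      have "a \<noteq> d" using False d by auto
      then have "inf a d \<prec> d" using md less.prems d by (intro inf_lower_covers_covered)
      then have "inf (inf a d) c \<preceq> c" using less.IH[of d] d by (auto simp: covered_by_def)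
      then show ?thesis using d by (simp add: inf.assoc inf_absorb2)
    qed
  qed
  have "inf a c \<preceq> inf b c" if "a \<prec> b" for a b c :: 'a
  proof -
    have "a \<le> b" using that by (auto simp: covered_by_def)
    have "inf a (inf b c) \<preceq> inf b c" by (rule below[OF that inf_le1])
    moreover have "inf a (inf b c) = inf a c"
      using \<open>a \<le> b\<close> by (metis inf.assoc inf_absorb1)
    ultimately show ?thesis by simp
  qed
  then show ?thesis unfolding lower_semimodular_def by blast
qed

text \<open>
  This is the anti-exchange property in lattice form. If \<open>p\<close> and \<open>q\<close> lie below lower covers \<open>w\<close>
  and \<open>z\<close> of \<open>u\<close>, then distributivity near \<open>u\<close> prevents \<open>inf w z\<close> from lying below \<open>v\<close>, so there is
  a join-irreducible \<open>r\<close> below \<open>inf w z\<close> but not below \<open>v\<close>. Comparing \<open>p\<close> with \<open>r\<close> across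
  \<open>inf v w \<prec> w\<close>, and \<open>q\<close> with \<open>r\<close> across \<open>inf v z \<prec> z\<close>, identifies all three.
\<close>

lemma Ji_unique_across_cover:
  fixes u :: "'a::{finite,bounded_lattice}"
  assumes md: "meet_distributive TYPE('a)"
    and "v \<prec> u" "p \<in> Ji" "p \<le> u" "\<not> p \<le> v" "q \<in> Ji" "q \<le> u" "\<not> q \<le> v"
  shows "p = q"
  using assms(2-)
proof (induction u arbitrary: v p q rule: finite_order_induct)
  case (less u)
  note v = \<open>v \<prec> u\<close>
  show ?case
  proof (cases "p = u \<or> q = u")
    case True
    then show ?thesis using less.prems le_lower_cover_of_Ji by (metis le_less)
  next
    case False
    then have "p < u" "q < u" using less.prems by auto
    obtain w where w: "p \<le> w" "w \<prec> u" using \<open>p < u\<close> by (rule ex_lower_cover_above)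
    obtain z where z: "q \<le> z" "z \<prec> u" using \<open>q < u\<close> by (rule ex_lower_cover_above)
    have "v \<noteq> w" "v \<noteq> z" using w z less.prems by auto
    have vw: "inf v w \<prec> w" and vz: "inf v z \<prec> z"
      using md v w z \<open>v \<noteq> w\<close> \<open>v \<noteq> z\<close> by (auto intro: inf_lower_covers_covered)
    have "w < u" "z < u" using w z by (auto simp: covered_by_def)
    have "\<not> inf w z \<le> v"
    proof
      assume le: "inf w z \<le> v"
      have "\<not> z \<le> v" using z v \<open>v \<noteq> z\<close> by (auto simp: covered_by_def less_le)
      then have "sup v z = u" using v \<open>z < u\<close> by (intro sup_eq_of_covered_by) auto
      then have "w = inf w (sup v z)" using \<open>w < u\<close> by (simp add: inf_absorb1)
      also have "\<dots> = sup (inf w v) (inf w z)"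
        using v w z by (intro inf_sup_distrib_near[OF md, of u])
          (auto simp: lower_star_le covered_by_def)
      also have "\<dots> \<le> v" using le by simp
      finally show False using w less.prems by auto
    qed
    then obtain r where r: "r \<in> Ji" "r \<le> inf w z" "\<not> r \<le> v" by (rule Ji_separates)
    have "p = r"
      using less.IH[OF \<open>w < u\<close> vw, of p r] r w less.prems by auto
    moreover have "q = r"
      using less.IH[OF \<open>z < u\<close> vz, of q r] r z less.prems by auto
    ultimately show ?thesis by simp
  qed
qed

lemma ex_chain_card_Ji:
  fixes u :: "'a::{finite,bounded_lattice}"
  assumes md: "meet_distributive TYPE('a)"
  shows "\<exists>C \<subseteq> {..u}. Complete_Partial_Order.chain (\<le>) C \<and> card (Ji \<inter> {..u}) + 1 \<le> card C"
proof (induction u rule: finite_order_induct)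
  case (less u)
  show ?case
  proof (cases "u = bot")
    case True
    have "Ji \<inter> {..bot::'a} = {}" by (auto simp: Ji_def covered_by_def bot_unique)
    with True show ?thesis
      by (intro exI[of _ "{bot}"]) (auto simp: Complete_Partial_Order.chain_def)
  next
    case False
    then have "bot < u" by (simp add: bot.not_eq_extremum)
    then obtain v where v: "v \<prec> u" by (rule ex_lower_cover_above)
    then have "v < u" by (simp add: covered_by_def)
    from less[OF this] obtain C where C: "C \<subseteq> {..v}" "Complete_Partial_Order.chain (\<le>) C"
      "card (Ji \<inter> {..v}) + 1 \<le> card C" by blast
    have "u \<notin> C" using C \<open>v < u\<close> by auto
    obtain p where p: "p \<in> Ji" "p \<le> u" "\<not> p \<le> v" using \<open>v < u\<close> Ji_separates by (meson leD)
    have "Ji \<inter> {..u} \<subseteq> insert p (Ji \<inter> {..v})"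
      using Ji_unique_across_cover[OF md v] p by blast
    then have "card (Ji \<inter> {..u}) \<le> card (insert p (Ji \<inter> {..v}))" by (intro card_mono) auto
    also have "\<dots> \<le> card (Ji \<inter> {..v}) + 1" by (simp add: card_insert_if)
    also have "\<dots> \<le> card C" using C by simp
    finally have "card (Ji \<inter> {..u}) + 1 \<le> card (insert u C)" using \<open>u \<notin> C\<close> by simp
    moreover have "Complete_Partial_Order.chain (\<le>) (insert u C)"
      using C \<open>v < u\<close> by (fastforce simp: Complete_Partial_Order.chain_def)
    moreover have "insert u C \<subseteq> {..u}" using C \<open>v < u\<close> by auto
    ultimately show ?thesis by blast
  qed
qed

lemma card_Ji_le_lattice_length:
  assumes "meet_distributive TYPE('a::{finite,bounded_lattice})"
  shows "card (Ji :: 'a set) \<le> lattice_length TYPE('a)"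
proof -
  obtain C :: "'a set" where C: "Complete_Partial_Order.chain (\<le>) C"
    "card (Ji \<inter> {..top::'a}) + 1 \<le> card C"
    using ex_chain_card_Ji[OF assms, of top] by auto
  have "card C \<le> Max (card ` {C :: 'a set. Complete_Partial_Order.chain (\<le>) C})"
    using C(1) by (intro Max_ge finite_imageI imageI finite) simp
  moreover have "{..top::'a} = UNIV" by (simp add: atMost_eq_UNIV_iff)
  ultimately show ?thesis using C(2) by (simp add: lattice_length_def)
qed

section \<open>Dually slim lattices\<close>

lemma dually_slim_no_three:
  assumes "dually_slim TYPE('a::{finite,bounded_lattice})"
    and "l \<in> (Mi :: 'a set)" "m \<in> Mi" "n \<in> Mi"
  shows "l \<le> m \<or> m \<le> l \<or> l \<le> n \<or> n \<le> l \<or> m \<le> n \<or> n \<le> m"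
proof (rule ccontr)
  assume *: "\<not> ?thesis"
  then have "card {l, m, n} = 3" by (auto simp: card_insert_if)
  moreover have "antichain {l, m, n}" using * by (auto simp: antichain_def incomparable_def)
  moreover have "{l, m, n} \<subseteq> Mi" using assms by simp
  ultimately show False using assms(1) unfolding dually_slim_def by blast
qed

text \<open>
  Otherwise each element is separated from the join of the other two by a meet-irreducible, which is
  above two of the three elements and not above the third. These three are pairwise incomparable.
\<close>

lemma dually_slim_le_sup:
  fixes x y z :: "'a::{finite,bounded_lattice}"
  assumes ds: "dually_slim TYPE('a)"
  shows "x \<le> sup y z \<or> y \<le> sup x z \<or> z \<le> sup x y"
proof (rule ccontr)
  assume *: "\<not> ?thesis"
  obtain l where l: "l \<in> Mi" "sup y z \<le> l" "\<not> x \<le> l" using * Mi_separates[of x "sup y z"] by auto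
  obtain m where m: "m \<in> Mi" "sup x z \<le> m" "\<not> y \<le> m" using * Mi_separates[of y "sup x z"] by auto
  obtain n where n: "n \<in> Mi" "sup x y \<le> n" "\<not> z \<le> n" using * Mi_separates[of z "sup x y"] by auto
  show False
    using dually_slim_no_three[OF ds l(1) m(1) n(1)] l m n by (meson le_sup_iff order_trans)
qed

text \<open>
  If the meet \<open>p\<close> of \<open>sup x z\<close> and \<open>y\<close> were nonzero, one could separate \<open>z\<close> from \<open>y\<close>, \<open>p\<close> from
  \<open>x\<close>, and \<open>p\<close> from \<open>z\<close> by meet-irreducibles. The first cannot be above \<open>x\<close>, since \<open>z \<le> sup x y\<close>; the
  other two cannot be above \<open>y\<close>, nor above both \<open>x\<close> and \<open>z\<close>, since \<open>p\<close> is below \<open>y\<close> and below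
  \<open>sup x z\<close>. So each is above exactly one of \<open>y\<close>, \<open>x\<close>, \<open>z\<close>, a different one each time, and they
  form an antichain.
\<close>

lemma dually_slim_between:
  fixes x y z :: "'a::{finite,bounded_lattice}"
  assumes ds: "dually_slim TYPE('a)"
    and "z \<le> sup x y" "inf x y = bot" "inf y z = bot"
  shows "inf (sup x z) y = bot"
proof (rule ccontr)
  let ?p = "inf (sup x z) y"
  assume p: "?p \<noteq> bot"
  have "z \<noteq> bot" using p assms(3) by auto
  then have "\<not> z \<le> y" using assms(4) by (auto simp: inf_absorb2)
  have "\<not> ?p \<le> x" "\<not> ?p \<le> z"
    using p assms(3,4) by (metis bot.extremum_uniqueI inf.bounded_iff inf_le2)+
  obtain l where l: "l \<in> Mi" "y \<le> l" "\<not> z \<le> l" using \<open>\<not> z \<le> y\<close> by (rule Mi_separates)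
  obtain m where m: "m \<in> Mi" "x \<le> m" "\<not> ?p \<le> m" using \<open>\<not> ?p \<le> x\<close> by (rule Mi_separates)
  obtain n where n: "n \<in> Mi" "z \<le> n" "\<not> ?p \<le> n" using \<open>\<not> ?p \<le> z\<close> by (rule Mi_separates)
  have "\<not> x \<le> l" using l assms(2) by (meson le_sup_iff order_trans sup_least)
  moreover have "\<not> y \<le> m" "\<not> y \<le> n" using m n by (meson inf_le2 order_trans)+
  moreover have "\<not> z \<le> m" "\<not> x \<le> n" using m n by (meson inf_le1 order_trans sup_least)+
  ultimately show False
    using dually_slim_no_three[OF ds l(1) m(1) n(1)] l m n by (meson order_trans)
qed

text \<open>
  A lower cover of \<open>u\<close> is the meet of \<open>u\<close> with a meet-irreducible, and lower covers are pairwise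
  incomparable, so three of them would give a three-element antichain in \<open>Mi\<close>.
\<close>

lemma dually_slim_lower_covers:
  fixes u :: "'a::{finite,bounded_lattice}"
  assumes ds: "dually_slim TYPE('a)" and "v \<prec> u" "w \<prec> u" "t \<prec> u"
  shows "v = w \<or> v = t \<or> w = t"
proof (rule ccontr)
  assume *: "\<not> ?thesis"
  have sep: "\<exists>m\<in>Mi. inf u m = x" if "x \<prec> u" for x
  proof -
    have "\<not> u \<le> x" using that by (auto simp: covered_by_def)
    then obtain m where m: "m \<in> Mi" "x \<le> m" "\<not> u \<le> m" by (rule Mi_separates)
    have "inf u m < u" using m by (simp add: less_le_not_le)
    moreover have "x \<le> inf u m" using that m by (simp add: covered_by_def less_imp_le)
    ultimately have "inf u m = x" using that by (auto simp: covered_by_def le_less)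
    with m show ?thesis by auto
  qed
  have incomp: "x = y" if "x \<prec> u" "y \<prec> u" "x \<le> y" for x y
    using that by (auto simp: covered_by_def less_le)
  obtain l m n where "l \<in> Mi" "m \<in> Mi" "n \<in> Mi" "inf u l = v" "inf u m = w" "inf u n = t"
    using sep assms(2-4) by metis
  with dually_slim_no_three[OF ds, of l m n] * incomp assms(2-4) show False
    by (metis inf_mono order_refl)
qed

lemma distributive_on_square:
  fixes l u v w :: "'a::lattice"
  assumes "inf v w = l" "sup v w = u"
  shows "distributive_on {l, v, w, u}"
proof -
  have le: "l \<le> v" "l \<le> w" "v \<le> u" "w \<le> u" "l \<le> u"
    using assms by (auto intro: le_infI1 le_supI1)
  have "inf w v = l" "sup w v = u" using assms by (simp_all add: inf.commute sup.commute)
  then show ?thesis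
    by (simp add: distributive_on_def assms le[THEN inf_absorb1] le[THEN inf_absorb2]
        le[THEN sup_absorb1] le[THEN sup_absorb2])
qed

text \<open>
  As \<open>u\<close> has at most two lower covers, the interval below it is either a two-element chain or, by
  lower semimodularity, the four-element square spanned by the two lower covers.
\<close>

lemma dually_slim_lower_semimodular_imp_meet_distributive:
  assumes ds: "dually_slim TYPE('a::{finite,bounded_lattice})"
    and lsm: "lower_semimodular TYPE('a)"
  shows "meet_distributive TYPE('a)"
  unfolding meet_distributive_def
proof (intro allI impI)
  fix u :: 'a assume "u \<noteq> bot"
  then have "bot < u" by (simp add: bot.not_eq_extremum)
  then obtain v where v: "v \<prec> u" by (rule ex_lower_cover_above)
  show "distributive_on {lower_star u..u}"
  proof (cases "\<exists>w. w \<prec> u \<and> w \<noteq> v")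
    case False
    then have "x \<prec> u \<longleftrightarrow> x = v" for x using v by blast
    then have "{v. v \<prec> u} = {v}" by simp
    then have ls: "lower_star u = v" by (simp add: lower_star_def)
    have "{lower_star u..u} = {v, u}" using v ls by (auto simp: covered_by_def le_less)
    moreover have "v \<le> u" using v by (auto simp: covered_by_def)
    ultimately show ?thesis
      \<comment> \<open>The two-element chain is the square spanned by two comparable elements.\<close>
      using distributive_on_square[of v u v u] by (simp add: inf_absorb1 sup_absorb2 insert_absorb)
  next
    case True
    then obtain w where w: "w \<prec> u" "w \<noteq> v" by blast
    have "x \<prec> u \<longleftrightarrow> x = v \<or> x = w" for x
      using v w dually_slim_lower_covers[OF ds v w(1), of x] by auto
    then have cov: "{v. v \<prec> u} = {v, w}" by auto
    then have ls: "lower_star u = inf v w"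
      unfolding lower_star_def by (simp add: inf.commute)
    have le: "v \<le> u" "w \<le> u" using v w by (auto simp: covered_by_def)
    have "inf v w \<preceq> inf u w" "inf w v \<preceq> inf u v"
      using lsm v w unfolding lower_semimodular_def by blast+
    then have c: "inf v w \<preceq> w" "inf v w \<preceq> v"
      by (simp_all add: inf_absorb2[OF le(1)] inf_absorb2[OF le(2)] inf.commute[of w v])
    have between: "x = y \<or> x = z" if "y \<preceq> z" "y \<le> x" "x \<le> z" for x y z :: 'a
      using that unfolding covered_by_or_eq_def covered_by_def by (metis antisym le_less)
    have "{lower_star u..u} = {inf v w, v, w, u}" (is "_ = ?S")
    proof (intro set_eqI iffI)
      fix x assume x: "x \<in> {lower_star u..u}"
      show "x \<in> ?S"
      proof (cases "x = u")
        case False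
        with x have "x < u" by auto
        then obtain t where "x \<le> t" "t \<prec> u" by (rule ex_lower_cover_above)
        with cov have "x \<le> v \<or> x \<le> w" by auto
        moreover have "inf v w \<le> x" using x ls by simp
        ultimately show ?thesis using between[OF c(1)] between[OF c(2)] by blast
      qed simp
    qed (use le ls in \<open>auto intro: le_infI1\<close>)
    moreover have "sup v w = u"
      using v w le by (intro sup_eq_of_covered_by) (auto simp: covered_by_def less_le)
    ultimately show ?thesis
      using distributive_on_square[of v w "inf v w" u] by simp
  qed
qed

section \<open>Maximal CD-independent sets\<close>

text \<open>
  This is the only property of the lattice that bounds the number of maximal elements of
  \<open>X - {top}\<close>; it has different reasons in the dually slim and in the distributive case.
\<close>

definition disjoint_join_property :: "'a::{finite,bounded_lattice} itself \<Rightarrow> bool"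
  where "disjoint_join_property (_ :: 'a itself) \<longleftrightarrow>
    (\<forall>A :: 'a set. 3 \<le> card A \<and> (\<forall>x\<in>A. \<forall>y\<in>A. x \<noteq> y \<longrightarrow> inf x y = bot) \<longrightarrow>
      (\<exists>x\<in>A. \<exists>y\<in>A. x \<noteq> y \<and> (\<forall>z\<in>A - {x, y}. inf (sup x y) z = bot)))"

text \<open>
  A minimal one among the joins of two elements of \<open>A\<close> is disjoint from the rest. For suppose
  \<open>inf (sup x y) z\<close> is nonzero. Then neither \<open>x\<close> nor \<open>y\<close> is between the other two, by
  \<open>dually_slim_between\<close>. So \<open>z\<close> is between \<open>x\<close> and \<open>y\<close>, and \<open>sup x z \<le> sup x y\<close>. Minimality gives
  equality, which puts \<open>y\<close> between \<open>x\<close> and \<open>z\<close> after all.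
\<close>

lemma dually_slim_disjoint_join_property:
  assumes ds: "dually_slim TYPE('a::{finite,bounded_lattice})"
  shows "disjoint_join_property TYPE('a)"
  unfolding disjoint_join_property_def
proof (intro allI impI, elim conjE)
  fix A :: "'a set"
  assume card: "3 \<le> card A" and disj: "\<forall>x\<in>A. \<forall>y\<in>A. x \<noteq> y \<longrightarrow> inf x y = bot"
  define J where "J = {sup x y |x y. x \<in> A \<and> y \<in> A \<and> x \<noteq> y}"
  obtain s t where "s \<in> A" "t \<in> A" "s \<noteq> t"
    using card by (metis One_nat_def card_le_Suc0_iff_eq finite not_less_eq_eq numeral_3_eq_3
        Suc_leD)
  then have "J \<noteq> {}" by (auto simp: J_def)
  then obtain b where b: "b \<in> J" and min: "\<forall>c\<in>J. c \<le> b \<longrightarrow> b = c"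
    using finite_has_minimal[of J] by auto
  obtain x y where xy: "x \<in> A" "y \<in> A" "x \<noteq> y" "b = sup x y" using b by (auto simp: J_def)
  have "inf (sup x y) z = bot" if z: "z \<in> A - {x, y}" for z
  proof (rule ccontr)
    assume meets: "inf (sup x y) z \<noteq> bot"
    have btw: "inf (sup p r) q = bot" if "r \<le> sup p q" "{p, q, r} \<subseteq> A" "p \<noteq> q" "q \<noteq> r" for p q r
      using that disj by (intro dually_slim_between[OF ds]) auto
    have "\<not> x \<le> sup y z" "\<not> y \<le> sup x z"
      using meets btw[of x y z] btw[of y x z] xy z by (auto simp: sup.commute)
    then have le: "z \<le> sup x y" using dually_slim_le_sup[OF ds, of x y z] by auto
    moreover have "sup x z \<in> J" using xy z by (auto simp: J_def)
    ultimately have "sup x z = sup x y" using min xy by auto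
    with \<open>\<not> y \<le> sup x z\<close> show False by simp
  qed
  with xy show "\<exists>x\<in>A. \<exists>y\<in>A. x \<noteq> y \<and> (\<forall>z\<in>A - {x, y}. inf (sup x y) z = bot)" by blast
qed

lemma distributive_disjoint_join_property:
  assumes d: "distributive_on (UNIV :: 'a::{finite,bounded_lattice} set)"
  shows "disjoint_join_property TYPE('a)"
  unfolding disjoint_join_property_def
proof (intro allI impI, elim conjE)
  fix A :: "'a set"
  assume card: "3 \<le> card A" and disj: "\<forall>x\<in>A. \<forall>y\<in>A. x \<noteq> y \<longrightarrow> inf x y = bot"
  obtain s t where st: "s \<in> A" "t \<in> A" "s \<noteq> t"
    using card by (metis One_nat_def card_le_Suc0_iff_eq finite not_less_eq_eq numeral_3_eq_3
        Suc_leD)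
  have "inf (sup s t) z = bot" if "z \<in> A - {s, t}" for z
  proof -
    have "inf z (sup s t) = sup (inf z s) (inf z t)" using d by (auto simp: distributive_on_def)
    also have "\<dots> = bot" using disj st that by auto
    finally show ?thesis by (simp add: inf.commute)
  qed
  with st show "\<exists>x\<in>A. \<exists>y\<in>A. x \<noteq> y \<and> (\<forall>z\<in>A - {x, y}. inf (sup x y) z = bot)" by blast
qed

lemma maximal_CD_independent_mem:
  fixes X :: "'a::{finite,bounded_lattice} set"
  assumes "maximal_CD_independent UNIV X"
    and "\<And>x. x \<in> X \<Longrightarrow> x \<parallel> b \<Longrightarrow> inf x b = bot"
  shows "b \<in> X"
proof -
  have "CD_independent UNIV (insert b X)"
    using assms by (auto simp: maximal_CD_independent_def CD_independent_def incomparable_def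
        inf.commute)
  then show ?thesis using assms(1) by (auto simp: maximal_CD_independent_def)
qed

context
  fixes X :: "'a::{finite,bounded_lattice} set" and M :: "'a set"
  assumes M_def: "M = maximals (X - {top})"
begin

lemma below_max_cases:
  assumes "x \<in> X"
  obtains "x = top" | m where "m \<in> M" "x \<le> m"
  using assms le_maximals[of x "X - {top}"] by (auto simp: M_def)

lemma below_max: "x \<in> X \<Longrightarrow> x = top \<or> (\<exists>m\<in>M. x \<le> m)"
  by (metis below_max_cases)

lemma max_subset: "m \<in> M \<Longrightarrow> m \<in> X" "m \<in> M \<Longrightarrow> m \<noteq> top"
  by (auto simp: M_def maximals_def)

lemma above_max: "m \<in> M \<Longrightarrow> m \<le> x \<Longrightarrow> x \<in> X \<Longrightarrow> x = m \<or> x = top"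
  by (auto simp: M_def maximals_def le_less)

lemma max_incomparable: "m \<in> M \<Longrightarrow> n \<in> M \<Longrightarrow> m \<noteq> n \<Longrightarrow> m \<parallel> n"
  by (auto simp: M_def maximals_def incomparable_def less_le)

lemma max_disjoint:
  assumes "CD_independent UNIV X" "m \<in> M" "n \<in> M" "m \<noteq> n"
  shows "inf m n = bot"
  using assms max_incomparable max_subset by (auto simp: CD_independent_def)

lemma bot_notin_max:
  assumes "2 \<le> card M"
  shows "bot \<notin> M"
proof
  assume "bot \<in> M"
  then have "M \<subseteq> {bot}" using max_incomparable[of bot] by (auto simp: incomparable_def)
  then have "card M \<le> 1" using card_mono[of "{bot}" M] by simp
  with assms show False by simp
qed

lemma card_max_le_two:
  assumes join: "disjoint_join_property TYPE('a)" and max: "maximal_CD_independent UNIV X"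
  shows "card M \<le> 2"
proof (rule ccontr)
  assume "\<not> card M \<le> 2"
  then have card: "3 \<le> card M" by simp
  have bot: "bot \<notin> M" using bot_notin_max card by simp
  have "\<forall>m\<in>M. \<forall>n\<in>M. m \<noteq> n \<longrightarrow> inf m n = bot"
    using max max_disjoint by (simp add: maximal_CD_independent_def)
  with join card obtain m n where mn: "m \<in> M" "n \<in> M" "m \<noteq> n"
    and rest: "\<forall>z\<in>M - {m, n}. inf (sup m n) z = bot"
    unfolding disjoint_join_property_def by blast
  have "sup m n \<in> X"
  proof (rule maximal_CD_independent_mem[OF max])
    fix x assume x: "x \<in> X" "x \<parallel> sup m n"
    from \<open>x \<in> X\<close> show "inf x (sup m n) = bot"
    proof (cases rule: below_max_cases)
      case 1
      then show ?thesis using x by (simp add: incomparable_def)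
    next
      case (2 z)
      then have "z \<in> M - {m, n}" using x(2) by (auto simp: incomparable_def intro: le_supI1 le_supI2)
      with rest have "inf (sup m n) z = bot" by blast
      with 2 show ?thesis by (metis bot.extremum_uniqueI inf.commute inf_mono order_refl)
    qed
  qed
  then have "sup m n = top" using above_max[of m "sup m n"] above_max[of n "sup m n"] mn by auto
  moreover obtain z where "z \<in> M - {m, n}"
  proof -
    have "card {m, n} < card M" using card by (simp add: card_insert_if)
    then have "\<not> M \<subseteq> {m, n}" using card_mono[of "{m, n}" M] by auto
    then show thesis using that by blast
  qed
  ultimately show False using rest bot by (metis DiffD1 inf_top_left)
qed

text \<open>
  An element strictly between \<open>m\<close> and \<open>top\<close> is comparable with all of \<open>X\<close>, so it would belong to
  \<open>X\<close> and contradict the maximality of \<open>m\<close>.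
\<close>

lemma single_maximal:
  assumes max: "maximal_CD_independent UNIV X" and M: "M = {m}"
  shows "coatom m" "maximal_CD_independent {..m} (X - {top})"
proof -
  have le: "x \<le> m" if "x \<in> X" "x \<noteq> top" for x
    using that below_max[of x] M by auto
  have m: "m \<in> X" "m \<noteq> top" using max_subset M by auto
  have False if "m < c" "c < top" for c
  proof -
    have "c \<in> X"
      using that le by (intro maximal_CD_independent_mem[OF max]) (force simp: incomparable_def)
    then show False using le[of c] that by (metis leD less_irrefl)
  qed
  then show "coatom m" using m by (auto simp: coatom_def covered_by_def top.not_eq_extremum)
  show "maximal_CD_independent {..m} (X - {top})"
    unfolding maximal_CD_independent_def
  proof (intro conjI allI impI; (elim conjE)?)
    show "CD_independent {..m} (X - {top})"
      using max le by (auto simp: maximal_CD_independent_def CD_independent_def)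
    fix Y assume Y: "CD_independent {..m} Y" "X - {top} \<subseteq> Y"
    have "top \<notin> Y" using Y m by (auto simp: CD_independent_def top_unique)
    have "Y \<subseteq> X"
    proof
      fix y assume "y \<in> Y"
      then show "y \<in> X"
        using Y by (intro maximal_CD_independent_mem[OF max])
          (auto simp: CD_independent_def incomparable_def)
    qed
    with Y \<open>top \<notin> Y\<close> show "Y = X - {top}" by auto
  qed
qed

text \<open>
  Every element of \<open>X\<close> is comparable with \<open>sup m n\<close>, which therefore lies in \<open>X\<close> and, being above
  both maximal elements, is \<open>top\<close>.
\<close>

lemma pair_maximal:
  assumes max: "maximal_CD_independent UNIV X" and M: "M = {m, n}" and "m \<noteq> n"
  shows "(m, n) \<in> ComplP" "maximal_CD_independent {..m} (X \<inter> {..m})"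
proof -
  have cd: "CD_independent UNIV X" using max by (simp add: maximal_CD_independent_def)
  have disj: "inf m n = bot" using max_disjoint[OF cd] M \<open>m \<noteq> n\<close> by auto
  have below: "x = top \<or> x \<le> m \<or> x \<le> n" if "x \<in> X" for x
    using that below_max[of x] M by auto
  have "sup m n \<in> X"
  proof (rule maximal_CD_independent_mem[OF max])
    fix x assume "x \<in> X" "x \<parallel> sup m n"
    then show "inf x (sup m n) = bot"
      using below[of x] by (auto simp: incomparable_def intro: le_supI1 le_supI2)
  qed
  then have "sup m n = top"
    using above_max[of m "sup m n"] above_max[of n "sup m n"] M \<open>m \<noteq> n\<close> by auto
  with disj show "(m, n) \<in> ComplP" by (simp add: ComplP_def)
  show "maximal_CD_independent {..m} (X \<inter> {..m})"
    unfolding maximal_CD_independent_def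
  proof (intro conjI allI impI; (elim conjE)?)
    show "CD_independent {..m} (X \<inter> {..m})" using cd by (auto simp: CD_independent_def)
    fix Y assume Y: "CD_independent {..m} Y" "X \<inter> {..m} \<subseteq> Y"
    have "Y \<subseteq> X"
    proof
      fix y assume "y \<in> Y"
      then have "y \<le> m" using Y by (auto simp: CD_independent_def)
      show "y \<in> X"
      proof (rule maximal_CD_independent_mem[OF max])
        fix x assume x: "x \<in> X" "x \<parallel> y"
        then consider "x \<le> m" | "x \<le> n" using below[of x] by (auto simp: incomparable_def)
        then show "inf x y = bot"
        proof cases
          case 1
          then show ?thesis using x Y \<open>y \<in> Y\<close> by (auto simp: CD_independent_def)
        next
          case 2
          then show ?thesis using disj \<open>y \<le> m\<close>
            by (metis bot.extremum_uniqueI inf.commute inf_mono)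
        qed
      qed
    qed
    with Y show "Y = X \<inter> {..m}" by (auto simp: CD_independent_def)
  qed
qed

text \<open>
  If \<open>d\<close> is disjoint from \<open>m\<close>, then it lies between the complements \<open>n\<close> and \<open>m\<close>, because
  \<open>sup n m = top\<close>. Hence \<open>sup n d\<close> is disjoint from \<open>m\<close>, can be added to \<open>X\<close>, and so equals \<open>n\<close>.
\<close>

lemma pair_pseudocomplement:
  assumes ds: "dually_slim TYPE('a)"
    and max: "maximal_CD_independent UNIV X" and M: "M = {m, n}" and "m \<noteq> n"
  shows "is_pseudocomplement m n"
proof -
  have compl: "inf m n = bot" "sup m n = top"
    using pair_maximal(1)[OF max M \<open>m \<noteq> n\<close>] by (auto simp: ComplP_def)
  have "bot \<notin> M" using bot_notin_max M \<open>m \<noteq> n\<close> by simp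
  then have "m \<noteq> bot" using M by auto
  have "d \<le> n" if d: "inf m d = bot" for d
  proof -
    have disj: "inf (sup n d) m = bot"
      using dually_slim_between[OF ds, of d n m] d compl by (simp add: sup.commute inf.commute)
    have "sup n d \<in> X"
    proof (rule maximal_CD_independent_mem[OF max])
      fix x assume x: "x \<in> X" "x \<parallel> sup n d"
      from \<open>x \<in> X\<close> show "inf x (sup n d) = bot"
      proof (cases rule: below_max_cases)
        case (2 z)
        then have "x \<le> m" using x M by (auto simp: incomparable_def intro: le_supI1)
        then show ?thesis using disj by (metis bot.extremum_uniqueI inf.commute inf_mono order_refl)
      qed (use x in \<open>simp add: incomparable_def\<close>)
    qed
    moreover have "sup n d \<noteq> top" using disj \<open>m \<noteq> bot\<close> by auto
    ultimately have "sup n d = n" using above_max[of n "sup n d"] M by auto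
    then show ?thesis by (metis sup_ge2)
  qed
  with compl show ?thesis by (simp add: is_pseudocomplement_def)
qed

lemma CD_independent_extension_subset:
  assumes Y: "CD_independent UNIV Y" and "X \<subseteq> Y" "m \<in> M"
    and max: "maximal_CD_independent {..m} (X \<inter> {..m})" and "y \<in> Y" "y \<le> m"
  shows "y \<in> X"
proof -
  have "CD_independent {..m} (Y \<inter> {..m})" using Y by (auto simp: CD_independent_def)
  then have "Y \<inter> {..m} = X \<inter> {..m}"
    using max \<open>X \<subseteq> Y\<close> by (auto simp: maximal_CD_independent_def)
  with assms show ?thesis by auto
qed

text \<open>
  An additional element other than \<open>top\<close> and not below the coatom \<open>m\<close> would be disjoint from
  \<open>m\<close>, hence an atom by lower semimodularity.
\<close>

lemma maximal_from_coatom: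
  assumes lsm: "lower_semimodular TYPE('a)" and "top \<in> X" and atoms: "Atoms \<subseteq> X"
    and M: "M = {m}" and "coatom m" and max: "maximal_CD_independent {..m} (X - {top})"
  shows "maximal_CD_independent UNIV X"
  unfolding maximal_CD_independent_def
proof (intro conjI allI impI; (elim conjE)?)
  have le: "x \<le> m" if "x \<in> X" "x \<noteq> top" for x
    using that below_max[of x] M by auto
  have m: "m \<in> X" "m \<noteq> top" using max_subset M by auto
  show "CD_independent UNIV X"
    unfolding CD_independent_def
  proof (intro conjI ballI impI)
    fix x y assume "x \<in> X" "y \<in> X" "x \<parallel> y"
    moreover from this have "x \<noteq> top" "y \<noteq> top" by (auto simp: incomparable_def)
    ultimately show "inf x y = bot"
      using max by (simp add: maximal_CD_independent_def CD_independent_def)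
  qed simp
  fix Y assume Y: "CD_independent UNIV Y" "X \<subseteq> Y"
  have eq: "X \<inter> {..m} = X - {top}" using le m by (auto simp: top_unique)
  have "y \<in> X" if "y \<in> Y" for y
  proof (cases "y \<le> m \<or> y = top")
    case True
    then show ?thesis
      using CD_independent_extension_subset[OF Y, of m y] max M that \<open>top \<in> X\<close> eq by auto
  next
    case False
    then have "m \<parallel> y"
      using \<open>coatom m\<close> by (auto simp: incomparable_def coatom_def covered_by_def le_less
          top.not_eq_extremum)
    then have "inf m y = bot" using Y m that by (auto simp: CD_independent_def)
    moreover have "inf m y \<preceq> inf top y"
      using lsm \<open>coatom m\<close> unfolding lower_semimodular_def coatom_def by blast
    ultimately have "y \<in> Atoms"
      using False by (auto simp: Atoms_def covered_by_or_eq_def)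
    then show ?thesis using atoms by auto
  qed
  with Y show "Y = X" by auto
qed

text \<open>
  An additional element that is neither below \<open>m\<close> nor below \<open>n\<close> is not disjoint from either of them,
  by pseudocomplementation. So it is above both, and their join is \<open>top\<close>.
\<close>

lemma maximal_from_pair:
  assumes "top \<in> X" and M: "M = {m, n}"
    and compl: "(m, n) \<in> ComplP" and pseud: "(m, n) \<in> PseudCP"
    and max: "\<forall>u\<in>{m, n}. maximal_CD_independent {..u} (X \<inter> {..u})"
  shows "maximal_CD_independent UNIV X"
  unfolding maximal_CD_independent_def
proof (intro conjI allI impI; (elim conjE)?)
  have below: "x = top \<or> x \<le> m \<or> x \<le> n" if "x \<in> X" for x
    using that below_max[of x] M by auto
  have disj: "inf m n = bot" "sup m n = top" using compl by (auto simp: ComplP_def)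
  have cross: "inf x y = bot" if "x \<le> m" "y \<le> n" for x y
    using that disj by (metis bot.extremum_uniqueI inf_mono)
  have same: "inf x y = bot" if "x \<in> X" "y \<in> X" "x \<parallel> y" "u \<in> {m, n}" "x \<le> u" "y \<le> u" for x y u
    using max that unfolding maximal_CD_independent_def CD_independent_def by blast
  show "CD_independent UNIV X"
    unfolding CD_independent_def
  proof (intro conjI ballI impI)
    fix x y assume xy: "x \<in> X" "y \<in> X" "x \<parallel> y"
    then have "x \<noteq> top" "y \<noteq> top" by (auto simp: incomparable_def)
    then show "inf x y = bot"
      using below[OF xy(1)] below[OF xy(2)] same[OF xy] cross[of x y] cross[of y x]
      by (auto simp: inf.commute)
  qed simp
  fix Y assume Y: "CD_independent UNIV Y" "X \<subseteq> Y"
  have "y \<in> X" if "y \<in> Y" for y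
  proof (cases "y \<le> m \<or> y \<le> n")
    case True
    then show ?thesis using CD_independent_extension_subset[OF Y] max M that by blast
  next
    case False
    have mn: "m \<in> Y" "n \<in> Y" using max_subset M Y by auto
    have "m \<le> y"
    proof (rule ccontr)
      assume "\<not> m \<le> y"
      then have "inf m y = bot" using False Y mn that by (auto simp: CD_independent_def incomparable_def)
      then show False using pseud False by (auto simp: PseudCP_def is_pseudocomplement_def)
    qed
    moreover have "n \<le> y"
    proof (rule ccontr)
      assume "\<not> n \<le> y"
      then have "inf n y = bot" using False Y mn that by (auto simp: CD_independent_def incomparable_def)
      then show False using pseud False by (auto simp: PseudCP_def is_pseudocomplement_def)
    qed
    ultimately have "y = top" using disj by (metis le_sup_iff top_unique)
    then show ?thesis using \<open>top \<in> X\<close> by simp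
  qed
  with Y show "Y = X" by auto
qed

end

section \<open>The characterization of maximal CD-independent sets\<close>

text \<open>
  Let \<open>a = inf u v\<close> for two upper covers \<open>u\<close> and \<open>v\<close>. Both meet \<open>b\<close>, as \<open>a\<close> is the largest element
  disjoint from \<open>b\<close>. Then among \<open>a\<close>, \<open>inf b u\<close> and \<open>inf b v\<close> none lies below the join of the other
  two: the join of the last two is below \<open>b\<close>, and the joins with \<open>a\<close> are below \<open>u\<close> and
  below \<open>v\<close>, which would put \<open>inf b v\<close> or \<open>inf b u\<close> below \<open>inf a b\<close>.
\<close>

lemma dually_slim_pseudocomplement_Mi:
  fixes a b :: "'a::{finite,bounded_lattice}"
  assumes ds: "dually_slim TYPE('a)" and "\<not> a \<le> b" "a \<noteq> top"
    and pseud: "is_pseudocomplement b a"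
  shows "a \<in> Mi"
proof (rule ccontr)
  assume "a \<notin> Mi"
  obtain u where "u \<in> {u. a < u}" and "\<forall>w\<in>{u. a < u}. w \<le> u \<longrightarrow> u = w"
    using finite_has_minimal2[of "{u. a < u}" top] \<open>a \<noteq> top\<close> by (auto simp: top.not_eq_extremum)
  then have u: "a \<prec> u" by (auto simp: covered_by_def dest: less_imp_le)
  with \<open>a \<notin> Mi\<close> obtain v where v: "a \<prec> v" "v \<noteq> u" by (auto simp: Mi_def)
  have "\<not> u \<le> v" using u v by (auto simp: covered_by_def le_less)
  then have "inf u v < u" by (simp add: less_le_not_le)
  moreover have "a \<le> inf u v" using u v by (simp add: covered_by_def less_imp_le)
  ultimately have uv: "inf u v = a" using u by (auto simp: covered_by_def le_less)
  have meets: "inf b w \<noteq> bot" if "a < w" for w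
    using pseud that by (auto simp: is_pseudocomplement_def)
  have ab: "inf a b = bot" using pseud by (simp add: is_pseudocomplement_def inf.commute)
  have le: "a \<le> u" "a \<le> v" using u v by (auto simp: covered_by_def)
  have "\<not> inf b u \<le> sup a (inf b v)"
  proof
    assume "inf b u \<le> sup a (inf b v)"
    also have "\<dots> \<le> v" using le by simp
    finally have "inf b u \<le> inf a b" using uv by (metis inf_le1 inf_le2 le_inf_iff)
    with ab meets[of u] u show False by (simp add: covered_by_def bot_unique)
  qed
  moreover have "\<not> inf b v \<le> sup a (inf b u)"
  proof
    assume "inf b v \<le> sup a (inf b u)"
    also have "\<dots> \<le> u" using le by simp
    finally have "inf b v \<le> inf a b" using uv by (metis inf_le1 inf_le2 le_inf_iff)
    with ab meets[of v] v show False by (simp add: covered_by_def bot_unique)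
  qed
  moreover have "\<not> a \<le> sup (inf b u) (inf b v)"
    using \<open>\<not> a \<le> b\<close> by (meson inf_le1 le_sup_iff order_trans sup_least)
  ultimately show False
    using dually_slim_le_sup[OF ds, of a "inf b u" "inf b v"] by (simp add: sup.commute)
qed

lemma distributive_imp_meet_distributive:
  "distributive_on (UNIV :: 'a::{finite,bounded_lattice} set) \<Longrightarrow> meet_distributive TYPE('a)"
  by (simp add: meet_distributive_def distributive_on_def)

lemma distributive_ComplP_imp_pseudocomplement:
  fixes a b :: "'a::{finite,bounded_lattice}"
  assumes d: "distributive_on (UNIV :: 'a set)" and "inf a b = bot" "sup a b = top"
  shows "is_pseudocomplement a b"
  unfolding is_pseudocomplement_def
proof (intro conjI allI impI)
  fix c assume c: "inf a c = bot"
  have "c = inf c (sup a b)" using assms by simp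
  also have "\<dots> = sup (inf c a) (inf c b)" using d by (auto simp: distributive_on_def)
  also have "\<dots> = inf c b" using c by (simp add: inf.commute)
  finally show "c \<le> b" by (metis inf_le2)
qed fact

lemma maximal_CD_independent_cases:
  fixes X M :: "'a::{finite,bounded_lattice} set"
  assumes M_def: "M = maximals (X - {top})" and "bot \<in> X" "(bot::'a) \<noteq> top"
    and enum: "M = a ` {1..card M}"
    and join: "disjoint_join_property TYPE('a)" and max: "maximal_CD_independent UNIV X"
  shows "card M = 1 \<and> coatom (a 1) \<and> maximal_CD_independent {..a 1} (X - {top}) \<or>
    card M = 2 \<and> (a 1, a 2) \<in> ComplP \<and> a 1 \<parallel> a 2 \<and>
      (\<forall>i\<in>{1, 2}. maximal_CD_independent {..a i} (X \<inter> {..a i}))"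
proof -
  have "M \<noteq> {}" using le_maximals[of bot "X - {top}"] assms(2,3) by (auto simp: M_def)
  then have "card M \<noteq> 0" by simp
  moreover have "card M \<le> 2" by (rule card_max_le_two[OF M_def join max])
  ultimately consider "card M = 1" | "card M = 2" by linarith
  then show ?thesis
  proof cases
    case 1
    then have "M = {a 1}" using enum by simp
    from single_maximal[OF M_def max this] 1 show ?thesis by simp
  next
    case 2
    have "{1..2::nat} = {1, 2}" by auto
    then have M: "M = {a 1, a 2}" using enum 2 by simp
    with 2 have ne: "a 1 \<noteq> a 2" by auto
    then have "M = {a 2, a 1}" using M by auto
    then show ?thesis
      using 2 M ne pair_maximal[OF M_def max M ne] pair_maximal(2)[OF M_def max, of "a 2" "a 1"]
        max_incomparable[OF M_def, of "a 1" "a 2"] by auto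
  qed
qed

lemma maximal_CD_independent_from_cases:
  fixes X M :: "'a::{finite,bounded_lattice} set"
  assumes M_def: "M = maximals (X - {top})" and sub: "{bot, top} \<union> Atoms \<subseteq> X"
    and enum: "M = a ` {1..card M}"
    and lsm: "lower_semimodular TYPE('a)"
    and cases: "card M = 1 \<and> coatom (a 1) \<and> maximal_CD_independent {..a 1} (X - {top}) \<or>
      card M = 2 \<and> (a 1, a 2) \<in> ComplP \<inter> PseudCP \<and>
        (\<forall>i\<in>{1, 2}. maximal_CD_independent {..a i} (X \<inter> {..a i}))"
  shows "maximal_CD_independent UNIV X"
  using cases
proof (elim disjE)
  assume 1: "card M = 1 \<and> coatom (a 1) \<and> maximal_CD_independent {..a 1} (X - {top})"
  then have "M = {a 1}" using enum by simp
  with 1 sub show ?thesis by (intro maximal_from_coatom[OF M_def lsm]) auto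
next
  assume 2: "card M = 2 \<and> (a 1, a 2) \<in> ComplP \<inter> PseudCP \<and>
        (\<forall>i\<in>{1, 2}. maximal_CD_independent {..a i} (X \<inter> {..a i}))"
  have "{1..2::nat} = {1, 2}" by auto
  then have "M = {a 1, a 2}" using enum 2 by simp
  with 2 sub show ?thesis by (intro maximal_from_pair[OF M_def]) auto
qed

lemma dually_slim_pair:
  fixes X M :: "'a::{finite,bounded_lattice} set"
  assumes M_def: "M = maximals (X - {top})" and M: "M = {m, n}" and ne: "m \<noteq> n"
    and ds: "dually_slim TYPE('a)" and max: "maximal_CD_independent UNIV X"
  shows "(m, n) \<in> PseudCP" "{m, n} \<subseteq> Mi"
proof -
  have M': "M = {n, m}" and ne': "n \<noteq> m" using M ne by auto
  have p: "is_pseudocomplement m n" "is_pseudocomplement n m"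
    using pair_pseudocomplement[OF M_def ds max M ne] pair_pseudocomplement[OF M_def ds max M' ne']
    by auto
  then show "(m, n) \<in> PseudCP" by (simp add: PseudCP_def)
  have "m \<parallel> n" using max_incomparable[OF M_def] M ne by simp
  moreover have "m \<noteq> top" "n \<noteq> top" using max_subset(2)[OF M_def] M by auto
  ultimately show "{m, n} \<subseteq> Mi"
    using p dually_slim_pseudocomplement_Mi[OF ds] by (auto simp: incomparable_def)
qed

theorem theorem1p4:
  assumes "card (UNIV :: 'a::{finite,bounded_lattice} set) \<ge> 2"
  shows
    "(meet_distributive TYPE('a) \<longrightarrow>
       (\<forall>Y :: 'a set. CD_independent UNIV Y \<longrightarrow>
          card Y \<le> lattice_length TYPE('a) + card (Atoms :: 'a set)))
     \<and>
     (dually_slim TYPE('a) \<longrightarrow>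
        (lower_semimodular TYPE('a) \<longleftrightarrow> meet_distributive TYPE('a)))
     \<and>
     (\<forall>(X :: 'a set) (k :: nat) (a :: nat \<Rightarrow> 'a).
        {bot, top} \<union> Atoms \<subseteq> X \<and>
        k = card (maximals (X - {top})) \<and>
        maximals (X - {top}) = a ` {1..k} \<longrightarrow>
        (dually_slim TYPE('a) \<and> lower_semimodular TYPE('a) \<longrightarrow>
           (maximal_CD_independent UNIV X \<longleftrightarrow>
              (k = 1 \<and> coatom (a 1) \<and> maximal_CD_independent {..a 1} (X - {top})) \<or>
              (k = 2 \<and> (a 1, a 2) \<in> ComplP \<inter> PseudCP \<and> {a 1, a 2} \<subseteq> Mi \<and>
                 (\<forall>i\<in>{1, 2}. maximal_CD_independent {..a i} (X \<inter> {..a i}))))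
           \<and>
           (maximal_CD_independent UNIV X \<longleftrightarrow>
              (k = 1 \<and> coatom (a 1) \<and> maximal_CD_independent {..a 1} (X - {top})) \<or>
              (k = 2 \<and> (a 1, a 2) \<in> ComplP \<inter> PseudCP \<and> a 1 \<parallel> a 2 \<and>
                 (\<forall>i\<in>{1, 2}. maximal_CD_independent {..a i} (X \<inter> {..a i})))))
        \<and>
        (distributive_on (UNIV :: 'a set) \<longrightarrow>
           (maximal_CD_independent UNIV X \<longleftrightarrow>
              (k = 1 \<and> coatom (a 1) \<and> maximal_CD_independent {..a 1} (X - {top})) \<or>
              (k = 2 \<and> (a 1, a 2) \<in> ComplP \<and> a 1 \<parallel> a 2 \<and>
                 (\<forall>i\<in>{1, 2}. maximal_CD_independent {..a i} (X \<inter> {..a i}))))))"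
proof (intro conjI impI allI; (elim conjE)?)
  have bot_top: "(bot::'a) \<noteq> top"
  proof
    assume "(bot::'a) = top"
    then have "(UNIV :: 'a set) \<subseteq> {bot}" by (metis bot_unique singletonI subsetI top_greatest)
    then have "card (UNIV :: 'a set) \<le> card {bot::'a}" by (intro card_mono) auto
    with assms show False by simp
  qed
  {
    fix Y :: "'a set"
    assume md: "meet_distributive TYPE('a)" and Y: "CD_independent UNIV Y"
    show "card Y \<le> lattice_length TYPE('a) + card (Atoms :: 'a set)"
      using card_CD_independent_le[OF bot_top Y] card_Ji_le_lattice_length[OF md] by linarith
  next
    assume "dually_slim TYPE('a)"
    then show "lower_semimodular TYPE('a) \<longleftrightarrow> meet_distributive TYPE('a)"
      using dually_slim_lower_semimodular_imp_meet_distributive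
        meet_distributive_imp_lower_semimodular by blast
  }
  fix X :: "'a set" and k :: nat and a :: "nat \<Rightarrow> 'a"
  assume sub: "{bot, top} \<union> Atoms \<subseteq> X" and k: "k = card (maximals (X - {top}))"
    and enum: "maximals (X - {top}) = a ` {1..k}"
  define M where "M = maximals (X - {top})"
  let ?A = "maximal_CD_independent UNIV X"
  let ?one = "k = 1 \<and> coatom (a 1) \<and> maximal_CD_independent {..a 1} (X - {top})"
  let ?ideals = "\<forall>i\<in>{1, 2}. maximal_CD_independent {..a i} (X \<inter> {..a i})"
  have kM: "k = card M" and enumM: "M = a ` {1..card M}" using k enum by (auto simp: M_def)
  have forward: "?one \<or> k = 2 \<and> (a 1, a 2) \<in> ComplP \<and> a 1 \<parallel> a 2 \<and> ?ideals"
    if "disjoint_join_property TYPE('a)" ?A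
    using maximal_CD_independent_cases[OF M_def _ bot_top enumM that] sub kM by simp
  have backward: ?A
    if "lower_semimodular TYPE('a)" "?one \<or> k = 2 \<and> (a 1, a 2) \<in> ComplP \<inter> PseudCP \<and> ?ideals"
    using maximal_CD_independent_from_cases[OF M_def sub enumM that(1)] that(2) kM by simp
  have pair: "M = {a 1, a 2} \<and> a 1 \<noteq> a 2" if "k = 2"
  proof -
    have "{1..2::nat} = {1, 2}" by auto
    then have M: "M = {a 1, a 2}" using enumM kM that by simp
    with kM that show ?thesis by auto
  qed
  {
    assume ds: "dually_slim TYPE('a)" and lsm: "lower_semimodular TYPE('a)"
    have slim: "k = 2 \<and> ?A \<longrightarrow> (a 1, a 2) \<in> PseudCP \<and> {a 1, a 2} \<subseteq> Mi"
      using dually_slim_pair[OF M_def _ _ ds, of "a 1" "a 2"] pair by simp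
    note fw = forward[OF dually_slim_disjoint_join_property[OF ds]]
    note bw = backward[OF lsm]
    show "?A \<longleftrightarrow> ?one \<or>
        (k = 2 \<and> (a 1, a 2) \<in> ComplP \<inter> PseudCP \<and> {a 1, a 2} \<subseteq> Mi \<and> ?ideals)"
      using fw slim bw unfolding Int_iff by argo
    show "?A \<longleftrightarrow> ?one \<or>
        (k = 2 \<and> (a 1, a 2) \<in> ComplP \<inter> PseudCP \<and> a 1 \<parallel> a 2 \<and> ?ideals)"
      using fw slim bw unfolding Int_iff by argo
  next
    assume d: "distributive_on (UNIV :: 'a set)"
    have lsm: "lower_semimodular TYPE('a)"
      using d by (intro meet_distributive_imp_lower_semimodular distributive_imp_meet_distributive)
    have "(a 1, a 2) \<in> ComplP \<longrightarrow> (a 1, a 2) \<in> PseudCP"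
      using distributive_ComplP_imp_pseudocomplement[OF d, of "a 1" "a 2"]
        distributive_ComplP_imp_pseudocomplement[OF d, of "a 2" "a 1"]
      by (simp add: ComplP_def PseudCP_def inf.commute sup.commute)
    then show "?A \<longleftrightarrow> ?one \<or>
        (k = 2 \<and> (a 1, a 2) \<in> ComplP \<and> a 1 \<parallel> a 2 \<and> ?ideals)"
      using forward[OF distributive_disjoint_join_property[OF d]] backward[OF lsm]
      unfolding Int_iff by argo
  }
qed

end
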